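(* Let $\Xi$ be a stationary locally stable Gibbs process on $\mathbb{R}^d$ with intensity $\lambda$ and local stability constant $c^*>0$, and let $g\colon \mathbb{R}^d\to[0,1]$ be a measurable function for which $1-g$ has bounded support. Put $G=\int_{\mathbb{R}^d}(1-g(x))\,dx$. Then $$1-\lambda G \;\le\; \mathbb{E}\Bigl(\prod_{y\in\Xi} g(y)\Bigr)\;\le\; 1-\frac{\lambda}{c^*}\bigl(1-e^{-c^*G}\bigr).$$
   Context: Let $\mathfrak{N}$ be the space of locally finite point measures on $\mathbb{R}^d$ with the $\sigma$-algebra generated by the evaluation maps $\xi\mapsto\xi(A)$, $A\subset\mathbb{R}^d$ bounded Borel. A point process is a random element $\Xi$ of $\mathfrak{N}$. All point processes are simple (no multiple points), so configurations are identified with locally finite sets, and $y\in\xi$ means that $y$ lies in the support of $\xi$. A point process $\Xi$ on $\mathbb{R}^d$ is a Gibbs process with conditional intensity $\lambda(\cdot\mid\cdot)\colon\mathbb{R}^d\times\mathfrak{N}\to[0,\infty)$ (measurable) if it satisfies the Georgii--Nguyen--Zessin equation $$\mathbb{E}\Bigl(\int_{\mathbb{R}^d} h(x,\Xi\setminus\{x\})\,\Xi(dx)\Bigr)=\int_{\mathbb{R}^d}\mathbb{E}\bigl(h(x,\Xi)\lambda(x\mid\Xi)\bigr)\,dx$$ for all measurable $h\colon\mathbb{R}^d\times\mathfrak{N}\to[0,\infty)$. $\Xi$ need not be uniquely determined by $\lambda(\cdot\mid\cdot)$; results hold for every Gibbs process with the given conditional intensity. $\Xi$ is stationary if its distribution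 is invariant under translations. The intensity of a stationary $\Xi$ is the constant $\lambda=\mathbb{E}(\lambda(x\mid\Xi))$, i.e. $\mathbb{E}\,\Xi(A)=\lambda|A|$ for Borel sets $A$, where $|A|$ is Lebesgue measure. A stationary Gibbs process is locally stable with constant $c^*$ if $\lambda(x\mid\xi)\le c^*$ for all $x\in\mathbb{R}^d$ and all $\xi\in\mathfrak{N}$. *)

theory Defs
  imports "HOL-Probability.Probability"
begin

text \<open>
  All point processes are simple, so a configuration (a locally finite point measure without
  multiple points) is identified with its support, a locally finite set \<open>\<xi>\<close>; the
  value \<open>\<xi>(A)\<close> on a bounded Borel set \<open>A\<close> is then \<open>card (\<xi> \<inter> A)\<close>.
\<close>

definition locally_finite :: "'a::euclidean_space set \<Rightarrow> bool" where
  "locally_finite \<xi> \<longleftrightarrow> (\<forall>A. bounded A \<longrightarrow> finite (\<xi> \<inter> A))"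

definition config_space :: "'a::euclidean_space set measure" where
  "config_space =
    (SUP A \<in> {A \<in> sets borel. bounded A}.
      vimage_algebra {\<xi>. locally_finite \<xi>} (\<lambda>\<xi>. card (\<xi> \<inter> A)) (count_space UNIV))"

definition point_process :: "'w measure \<Rightarrow> ('w \<Rightarrow> 'a::euclidean_space set) \<Rightarrow> bool" where
  "point_process M \<Xi> \<longleftrightarrow> \<Xi> \<in> M \<rightarrow>\<^sub>M config_space"

definition conditional_intensity :: "('a::euclidean_space \<Rightarrow> 'a set \<Rightarrow> real) \<Rightarrow> bool" where
  "conditional_intensity ci \<longleftrightarrow>
    (\<lambda>(x, \<xi>). ci x \<xi>) \<in> borel_measurable (borel \<Otimes>\<^sub>M config_space) \<and>
    (\<forall>x. \<forall>\<xi>\<in>space config_space. 0 \<le> ci x \<xi>)"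

text \<open>
  The second conjunct below is the Georgii--Nguyen--Zessin equation; integrating against the
  point measure \<open>\<Xi>\<close> is integrating against counting measure on its support.
\<close>

definition gibbs_process ::
  "'w measure \<Rightarrow> ('w \<Rightarrow> 'a::euclidean_space set) \<Rightarrow> ('a \<Rightarrow> 'a set \<Rightarrow> real) \<Rightarrow> bool" where
  "gibbs_process M \<Xi> ci \<longleftrightarrow>
    point_process M \<Xi> \<and> conditional_intensity ci \<and>
    (\<forall>h :: 'a \<times> 'a set \<Rightarrow> real.
      h \<in> borel_measurable (borel \<Otimes>\<^sub>M config_space) \<longrightarrow>
      (\<forall>x. \<forall>\<xi>\<in>space config_space. 0 \<le> h (x, \<xi>)) \<longrightarrow>
      (\<integral>\<^sup>+\<omega>. (\<integral>\<^sup>+x. ennreal (h (x, \<Xi> \<omega> - {x})) \<partial>count_space (\<Xi> \<omega>)) \<partial>M) =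
      (\<integral>\<^sup>+x. (\<integral>\<^sup>+\<omega>. ennreal (h (x, \<Xi> \<omega>) * ci x (\<Xi> \<omega>)) \<partial>M) \<partial>lborel))"

definition stationary :: "'w measure \<Rightarrow> ('w \<Rightarrow> 'a::euclidean_space set) \<Rightarrow> bool" where
  "stationary M \<Xi> \<longleftrightarrow>
    (\<forall>v. distr M config_space (\<lambda>\<omega>. (+) v ` \<Xi> \<omega>) = distr M config_space \<Xi>)"

definition has_intensity :: "'w measure \<Rightarrow> ('w \<Rightarrow> 'a::euclidean_space set) \<Rightarrow> real \<Rightarrow> bool" where
  "has_intensity M \<Xi> lam \<longleftrightarrow> 0 \<le> lam \<and>
    (\<forall>A\<in>sets borel.
      (\<integral>\<^sup>+\<omega>. emeasure (count_space UNIV) (\<Xi> \<omega> \<inter> A) \<partial>M) = ennreal lam * emeasure lborel A)"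

definition locally_stable :: "('a::euclidean_space \<Rightarrow> 'a set \<Rightarrow> real) \<Rightarrow> real \<Rightarrow> bool" where
  "locally_stable ci c \<longleftrightarrow> (\<forall>x. \<forall>\<xi>\<in>space config_space. ci x \<xi> \<le> c)"

text \<open>
  The product of \<open>g\<close> over a possibly infinite configuration. Since \<open>prod\<close> is \<open>1\<close> on infinite sets,
  it is taken over the points with a factor different from \<open>1\<close>; these are finitely many when
  \<open>1 - g\<close> has bounded support and \<open>\<xi>\<close> is locally finite.
\<close>

definition config_prod :: "('a \<Rightarrow> real) \<Rightarrow> 'a::euclidean_space set \<Rightarrow> real" where
  "config_prod g \<xi> = (\<Prod>y\<in>{y \<in> \<xi>. g y \<noteq> 1}. g y)"

end

theory Submission
  imports Defs
begin

text \<open>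
  Write \<open>u = 1 - g\<close> and \<open>P\<^sub>t(\<xi>) = (\<Prod>y\<in>\<xi>. 1 - t u(y))\<close>, so that \<open>P\<^sub>1\<close> is the
  product in question and \<open>P\<^sub>0 = 1\<close>.

  The lower bound is the Weierstrass product inequality \<open>1 - P\<^sub>1(\<xi>) \<le> (\<Sum>y\<in>\<xi>. u(y))\<close>
  (\<open>one_minus_config_prod_le\<close>) in expectation: by Campbell's formula (\<open>Campbell\<close>) the
  sum has mean \<open>\<lambda>G\<close>.

  For the upper bound put \<open>K = c G\<close> and let \<open>D(t)\<close> be minus the derivative of \<open>E P\<^sub>t(\<Xi>)\<close>, that is, the
  mean of \<open>\<Sum>\<^sub>x u(x) \<Prod>\<^sub>z (1 - t u(z))\<close>, where \<open>x\<close> runs over \<open>\<Xi>\<close> and \<open>z\<close> over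
  \<open>\<Xi> - {x}\<close>. Then \<open>D(0) = \<lambda>G\<close>. Differentiating once more produces a sum over pairs of
  points; the Georgii--Nguyen--Zessin equation, applied to one point of the pair, together with the
  bound \<open>c\<close> on the conditional intensity gives \<open>D'(t) \<ge> - K D(t)\<close>. Hence
  \<open>D(t) \<ge> \<lambda>G exp(-Kt)\<close>, and \<open>1 - E P\<^sub>1(\<Xi>)\<close>, the integral of \<open>D\<close> over \<open>[0,1]\<close>, is at least
  \<open>(\<lambda>/c) (1 - exp(-K))\<close>.

  The formal proof carries out this argument in integrated form, so that nothing is differentiated
  under the expectation and no factorial moments of \<open>\<Xi>\<close> are needed. Let \<open>w\<close> be the integral of
  \<open>exp(-K(1-t))\<close> over \<open>t \<in> [0,1]\<close>, so that \<open>K w = 1 - exp(-K)\<close>, and let \<open>B(\<xi>)\<close> be the integral of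
  \<open>exp(-K(1-t)) (1 - P\<^sub>t(\<xi>))\<close>. The fundamental theorem of calculus for
  \<open>exp(-K(1-t)) (1 - P\<^sub>t(\<xi>))\<close> gives, for each single configuration (\<open>defect_identity\<close>),
  \<open>w (\<Sum>y\<in>\<xi>. u(y)) + K B(\<xi>) = (\<Sum>y\<in>\<xi>. u(y) B(\<xi> - {y})) + 1 - P\<^sub>1(\<xi>)\<close>.
  By the Georgii--Nguyen--Zessin equation the sum on the right has mean at most \<open>K E B(\<Xi>)\<close>
  (\<open>gibbs_process_reduced_Campbell_le\<close>). As \<open>B\<close> is bounded, this cancels against the
  mean of \<open>K B(\<Xi>)\<close> on the left, which leaves \<open>w \<lambda>G \<le> 1 - E P\<^sub>1(\<Xi>)\<close>; and \<open>w \<lambda>G = (\<lambda>/c) K w\<close>.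
\<close>

section \<open>Sums over the points of a configuration\<close>

lemma space_config_space: "space config_space = {\<xi>. locally_finite \<xi>}"
proof -
  have "{} \<in> {A :: 'a set. A \<in> sets borel \<and> bounded A}" by simp
  then show ?thesis unfolding config_space_def by (auto simp: space_Sup_eq_UN)
qed

lemma measurable_card_Int:
  assumes "A \<in> sets borel" "bounded A"
  shows "(\<lambda>\<xi>. card (\<xi> \<inter> A)) \<in> config_space \<rightarrow>\<^sub>M count_space UNIV"
  unfolding config_space_def
  by (rule measurable_SUP1[of A]) (use assms in \<open>auto intro!: measurable_vimage_algebra1\<close>)

definition config_sum :: "('a::euclidean_space \<Rightarrow> ennreal) \<Rightarrow> 'a set \<Rightarrow> ennreal" where
  "config_sum f \<xi> = (\<integral>\<^sup>+x. f x \<partial>count_space \<xi>)"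

lemma config_sum_indicator:
  "config_sum (indicator A) \<xi> = emeasure (count_space UNIV) (\<xi> \<inter> A)"
proof -
  have "config_sum (indicator A) \<xi> = (\<integral>\<^sup>+x. indicator (\<xi> \<inter> A) x \<partial>count_space UNIV)"
    unfolding config_sum_def
    by (simp add: nn_integral_count_space_indicator mult.commute Int_commute flip: indicator_inter_arith)
  then show ?thesis by simp
qed

lemma config_sum_eq_sum:
  assumes "finite F" "F \<subseteq> \<xi>" "\<And>x. x \<in> \<xi> - F \<Longrightarrow> f x = 0"
  shows "config_sum f \<xi> = (\<Sum>x\<in>F. f x)"
  unfolding config_sum_def
  by (rule nn_integral_count_space') (use assms in auto)

text \<open>
  The generating maps only count points in bounded sets; a general Borel set is exhausted by its
  intersections with balls, and the counts increase to the count on the whole set.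
\<close>

lemma measurable_config_count:
  assumes [measurable]: "A \<in> sets borel"
  shows "(\<lambda>\<xi>::'a::euclidean_space set. emeasure (count_space UNIV) (\<xi> \<inter> A))
    \<in> borel_measurable config_space"
proof -
  have eq: "emeasure (count_space UNIV) (\<xi> \<inter> A) =
      (SUP n. ennreal (card (\<xi> \<inter> (A \<inter> ball 0 (real n)))))"
    if "\<xi> \<in> space config_space" for \<xi> :: "'a set"
  proof -
    have fin: "finite (\<xi> \<inter> (A \<inter> ball 0 (real n)))" for n
      using that by (simp add: space_config_space locally_finite_def bounded_Int)
    have un: "(\<Union>n. \<xi> \<inter> (A \<inter> ball 0 (real n))) = \<xi> \<inter> A"
      using reals_Archimedean2 by auto
    have "(SUP n. emeasure (count_space UNIV) (\<xi> \<inter> (A \<inter> ball 0 (real n)))) =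
        emeasure (count_space UNIV) (\<Union>n. \<xi> \<inter> (A \<inter> ball 0 (real n)))"
      by (intro SUP_emeasure_incseq) (auto simp: incseq_def)
    then show ?thesis
      using fin by (simp add: un ennreal_of_nat_eq_real_of_nat del: UN_simps)
  qed
  have [measurable]: "(\<lambda>\<xi>::'a set. card (\<xi> \<inter> (A \<inter> ball 0 (real n))))
      \<in> config_space \<rightarrow>\<^sub>M count_space UNIV" for n
    by (intro measurable_card_Int) (auto simp: bounded_Int)
  show ?thesis
    by (subst measurable_cong[OF eq]) measurable
qed

lemma config_sum_mult:
  "config_sum (\<lambda>x. c * u x) \<xi> = c * config_sum u \<xi>"
  unfolding config_sum_def by (simp add: nn_integral_cmult)

lemma config_sum_add:
  "config_sum (\<lambda>x. u x + v x) \<xi> = config_sum u \<xi> + config_sum v \<xi>"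
  unfolding config_sum_def by (simp add: nn_integral_add)

lemma config_sum_SUP:
  assumes "incseq U"
  shows "config_sum (SUP i. U i) \<xi> = (SUP i. config_sum (U i) \<xi>)"
  unfolding config_sum_def SUP_apply
  by (rule nn_integral_monotone_convergence_SUP) (use assms in auto)

text \<open>
  Counts are the sums of indicators, so the claim passes from counts to all functions by the
  approximation of a measurable function from below by simple functions.
\<close>

lemma measurable_config_sum:
  assumes "f \<in> borel_measurable borel"
  shows "config_sum f \<in> borel_measurable config_space"
  using assms
proof (induction f rule: borel_measurable_induct)
  case (cong f g)
  then have "f = g" by auto
  with cong show ?case by simp
next
  case (set A)
  then show ?case
    unfolding config_sum_indicator[abs_def] by (intro measurable_config_count)
next
  case (mult u c)
  then show ?case by (simp add: config_sum_mult[abs_def])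
next
  case (add u v)
  then show ?case by (simp add: config_sum_add[abs_def])
next
  case (seq U)
  then have "config_sum (SUP i. U i) = (\<lambda>\<xi>. SUP i. config_sum (U i) \<xi>)"
    by (intro ext config_sum_SUP)
  with seq.IH show ?case by (auto intro!: borel_measurable_SUP simp del: SUP_apply Sup_apply)
qed

text \<open>
  The assumption on the intensity is the case of indicators; both sides are additive and continuous
  along increasing sequences.
\<close>

lemma Campbell:
  assumes "point_process M \<Xi>" "has_intensity M \<Xi> lam" "f \<in> borel_measurable borel"
  shows "(\<integral>\<^sup>+\<omega>. config_sum f (\<Xi> \<omega>) \<partial>M) = ennreal lam * (\<integral>\<^sup>+x. f x \<partial>lborel)"
proof -
  note [measurable] = measurable_config_sum
  have [measurable]: "\<Xi> \<in> M \<rightarrow>\<^sub>M config_space"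
    using assms(1) by (simp add: point_process_def)
  show ?thesis
    using assms(3)
  proof (induction f rule: borel_measurable_induct)
    case (cong f g)
    then have "f = g" by auto
    with cong show ?case by simp
  next
    case (set A)
    then show ?case
      using assms(2) by (simp add: config_sum_indicator has_intensity_def)
  next
    case (mult u c)
    note [measurable] = mult(2)
    show ?case
      by (simp add: config_sum_mult nn_integral_cmult mult mult.left_commute)
  next
    case (add u v)
    note [measurable] = add.hyps
    show ?case
      by (simp add: config_sum_add nn_integral_add add.IH distrib_left)
  next
    case (seq U)
    note [measurable] = seq.hyps(1)
    have "incseq (\<lambda>i \<omega>. config_sum (U i) (\<Xi> \<omega>))"
      using seq.hyps(3) by (auto simp: incseq_def le_fun_def config_sum_def intro!: nn_integral_mono)
    then have "(\<integral>\<^sup>+\<omega>. config_sum (SUP i. U i) (\<Xi> \<omega>) \<partial>M) =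
        (SUP i. \<integral>\<^sup>+\<omega>. config_sum (U i) (\<Xi> \<omega>) \<partial>M)"
      unfolding config_sum_SUP[OF seq.hyps(3)]
      by (intro nn_integral_monotone_convergence_SUP) measurable
    also have "\<dots> = ennreal lam * (SUP i. \<integral>\<^sup>+x. U i x \<partial>lborel)"
      by (simp add: seq.IH SUP_mult_left_ennreal)
    also have "(SUP i. \<integral>\<^sup>+x. U i x \<partial>lborel) = (\<integral>\<^sup>+x. (SUP i. U i) x \<partial>lborel)"
      unfolding SUP_apply
      by (intro nn_integral_monotone_convergence_SUP[symmetric] seq.hyps(3)) measurable
    finally show ?case .
  qed
qed

section \<open>Measurability of products and of their averages over thinnings\<close>

text \<open>
  A product of factors in \<open>[0,1]\<close> is \<open>0\<close> as soon as one factor vanishes, and otherwise it is the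
  exponential of a sum of logarithms; both alternatives are expressed by sums over points.
\<close>

lemma measurable_config_prod:
  fixes g :: "'a::euclidean_space \<Rightarrow> real"
  assumes [measurable]: "g \<in> borel_measurable borel"
    and g: "\<And>x. 0 \<le> g x \<and> g x \<le> 1"
    and bdd: "bounded {x. g x \<noteq> 1}"
  shows "config_prod g \<in> borel_measurable config_space"
proof -
  note [measurable] = measurable_config_sum
  have eq: "config_prod g \<xi> =
      (if config_sum (indicator {x. g x = 0}) \<xi> = 0
       then exp (- enn2real (config_sum (\<lambda>x. ennreal (- ln (g x))) \<xi>)) else 0)"
    if "\<xi> \<in> space config_space" for \<xi>
  proof -
    define F where "F = {y\<in>\<xi>. g y \<noteq> 1}"
    have "finite (\<xi> \<inter> {x. g x \<noteq> 1})"
      using that bdd by (simp add: space_config_space locally_finite_def)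
    then have F: "finite F" "F \<subseteq> \<xi>" by (auto simp: F_def Int_def)
    have zeros: "config_sum (indicator {x. g x = 0}) \<xi> = (\<Sum>x\<in>F. indicator {x. g x = 0} x)"
      by (rule config_sum_eq_sum[OF F]) (auto simp: F_def)
    show ?thesis
    proof (cases "\<exists>y\<in>F. g y = 0")
      case True
      then show ?thesis
        using F by (auto simp: zeros config_prod_def F_def[symmetric] indicator_def)
    next
      case False
      then have pos: "g y > 0" if "y \<in> F" for y using that g[of y] by force
      have "config_sum (\<lambda>x. ennreal (- ln (g x))) \<xi> = (\<Sum>x\<in>F. ennreal (- ln (g x)))"
        by (rule config_sum_eq_sum[OF F]) (auto simp: F_def)
      also have "\<dots> = ennreal (\<Sum>x\<in>F. - ln (g x))"
        using pos g by (intro sum_ennreal) (auto intro: ln_le_zero_iff[THEN iffD2])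
      finally have "config_sum (\<lambda>x. ennreal (- ln (g x))) \<xi> = ennreal (\<Sum>x\<in>F. - ln (g x))" .
      moreover have "0 \<le> (\<Sum>x\<in>F. - ln (g x))"
        using pos g by (intro sum_nonneg) (auto intro: ln_le_zero_iff[THEN iffD2])
      ultimately have "exp (- enn2real (config_sum (\<lambda>x. ennreal (- ln (g x))) \<xi>)) =
          exp (\<Sum>x\<in>F. ln (g x))"
        by (simp add: sum_negf)
      also have "\<dots> = (\<Prod>x\<in>F. g x)"
        using F pos by (simp add: exp_sum)
      finally show ?thesis
        using False F by (auto simp: zeros config_prod_def F_def[symmetric] indicator_def)
    qed
  qed
  show ?thesis
    by (subst measurable_cong[OF eq]) measurable
qed

text \<open>
  Round \<open>t\<close> down to a multiple of \<open>1/(n+1)\<close>. The rounded function is measurable in the pair,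
  because only countably many values of the parameter occur, and it converges by continuity.
\<close>

lemma borel_measurable_Caratheodory:
  fixes f :: "real \<Rightarrow> 'b \<Rightarrow> real"
  assumes meas: "\<And>t. f t \<in> borel_measurable N"
    and cont: "\<And>x. x \<in> space N \<Longrightarrow> continuous_on UNIV (\<lambda>t. f t x)"
  shows "(\<lambda>(x, t). f t x) \<in> borel_measurable (N \<Otimes>\<^sub>M borel)"
proof (rule borel_measurable_LIMSEQ_real)
  show "(\<lambda>(x, t). f (of_int \<lfloor>real (Suc n) * t\<rfloor> / real (Suc n)) x)
      \<in> borel_measurable (N \<Otimes>\<^sub>M borel)" for n
  proof -
    have "(\<lambda>p. f (of_int \<lfloor>real (Suc n) * snd p\<rfloor> / real (Suc n)) (fst p))
        \<in> borel_measurable (N \<Otimes>\<^sub>M borel)"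
      by (rule measurable_compose_countable[where
            f = "\<lambda>k p. f (of_int k / real (Suc n)) (fst p)"])
        (use meas in measurable)
    then show ?thesis by (simp add: case_prod_beta')
  qed
  fix p assume p: "p \<in> space (N \<Otimes>\<^sub>M (borel :: real measure))"
  obtain x t where xt: "p = (x, t)" by (cases p)
  have floor_bounds: "t - inverse (real (Suc n)) \<le> of_int \<lfloor>real (Suc n) * t\<rfloor> / real (Suc n)"
    "of_int \<lfloor>real (Suc n) * t\<rfloor> / real (Suc n) \<le> t" for n
  proof -
    define m where "m = real (Suc n)"
    have "m > 0" by (simp add: m_def)
    moreover have "m * t - 1 \<le> of_int \<lfloor>m * t\<rfloor>" "of_int \<lfloor>m * t\<rfloor> \<le> m * t" by linarith+
    ultimately show "t - inverse (real (Suc n)) \<le> of_int \<lfloor>real (Suc n) * t\<rfloor> / real (Suc n)"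
      "of_int \<lfloor>real (Suc n) * t\<rfloor> / real (Suc n) \<le> t"
      unfolding m_def[symmetric]
      by (simp_all add: pos_le_divide_eq pos_divide_le_eq left_diff_distrib right_diff_distrib mult.commute)
  qed
  have "(\<lambda>n. of_int \<lfloor>real (Suc n) * t\<rfloor> / real (Suc n)) \<longlonglongrightarrow> t"
  proof (rule tendsto_sandwich)
    show "\<forall>\<^sub>F n in sequentially. t - inverse (real (Suc n)) \<le> of_int \<lfloor>real (Suc n) * t\<rfloor> / real (Suc n)"
      using floor_bounds(1) by (intro always_eventually allI)
    show "\<forall>\<^sub>F n in sequentially. of_int \<lfloor>real (Suc n) * t\<rfloor> / real (Suc n) \<le> t"
      using floor_bounds(2) by (intro always_eventually allI)
    show "(\<lambda>n. t - inverse (real (Suc n))) \<longlonglongrightarrow> t"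
      using tendsto_diff[OF tendsto_const LIMSEQ_inverse_real_of_nat, of t] by simp
  qed simp
  moreover have "isCont (\<lambda>t. f t x) t"
    using cont[of x] p xt by (simp add: space_pair_measure continuous_on_eq_continuous_at)
  ultimately show "(\<lambda>n. case p of (x, t) \<Rightarrow> f (of_int \<lfloor>real (Suc n) * t\<rfloor> / real (Suc n)) x)
      \<longlonglongrightarrow> (case p of (x, t) \<Rightarrow> f t x)"
    by (auto simp: xt intro: isCont_tendsto_compose)
qed

text \<open>
  If every point of \<open>\<xi>\<close> is kept independently with probability \<open>t\<close>, then the product of
  \<open>1 - t (1 - g y)\<close> is the mean of \<open>config_prod g\<close> over the thinned configuration. The weight in
  \<open>t\<close> is the solution of \<open>e' = K e\<close> with \<open>e(1) = 1\<close>; its growth rate \<open>K\<close> produces the term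
  \<open>K * averaged_defect K g \<xi>\<close> in the identity below.
\<close>

definition averaged_defect :: "real \<Rightarrow> ('a::euclidean_space \<Rightarrow> real) \<Rightarrow> 'a set \<Rightarrow> real" where
  "averaged_defect K g \<xi> =
    (\<integral>t. exp (- K * (1 - t)) * (1 - config_prod (\<lambda>y. 1 - t * (1 - g y)) \<xi>) *
      indicator {0..1} t \<partial>lborel)"

lemma config_prod_thin:
  assumes "finite {y \<in> \<xi>. g y \<noteq> 1}"
  shows "config_prod (\<lambda>y. 1 - t * (1 - g y)) \<xi> = (\<Prod>y\<in>{y \<in> \<xi>. g y \<noteq> 1}. 1 - t * (1 - g y))"
  unfolding config_prod_def by (rule prod.mono_neutral_left) (use assms in auto)

lemma measurable_averaged_defect:
  assumes [measurable]: "g \<in> borel_measurable borel"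
    and g: "\<And>x. 0 \<le> g x \<and> g x \<le> 1"
    and bdd: "bounded {x. g x \<noteq> 1}"
  shows "averaged_defect K g \<in> borel_measurable config_space"
proof -
  \<comment> \<open>Outside \<open>[0,1]\<close> the factors can leave \<open>[0,1]\<close>. Clamping the parameter does not
    change the integral and makes \<open>measurable_config_prod\<close> applicable for every real \<open>t\<close>.\<close>
  define r :: "real \<Rightarrow> real" where "r t = max 0 (min 1 t)" for t
  have [measurable]: "(\<lambda>(\<xi>, t). config_prod (\<lambda>y. 1 - r t * (1 - g y)) \<xi>)
      \<in> borel_measurable (config_space \<Otimes>\<^sub>M borel)"
  proof (rule borel_measurable_Caratheodory)
    fix t
    have r: "0 \<le> r t" "r t \<le> 1" by (auto simp: r_def)
    show "config_prod (\<lambda>y. 1 - r t * (1 - g y)) \<in> borel_measurable config_space"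
    proof (rule measurable_config_prod)
      show "0 \<le> 1 - r t * (1 - g x) \<and> 1 - r t * (1 - g x) \<le> 1" for x
        using r g[of x] by (auto intro: mult_le_one)
      show "bounded {x. 1 - r t * (1 - g x) \<noteq> 1}"
        by (rule bounded_subset[OF bdd]) auto
    qed measurable
  next
    fix \<xi> :: "'a set" assume "\<xi> \<in> space config_space"
    then have "finite (\<xi> \<inter> {x. g x \<noteq> 1})"
      using bdd by (simp add: space_config_space locally_finite_def)
    then have "finite {y\<in>\<xi>. g y \<noteq> 1}" by (simp add: Int_def)
    then show "continuous_on UNIV (\<lambda>t. config_prod (\<lambda>y. 1 - r t * (1 - g y)) \<xi>)"
      by (simp add: config_prod_thin) (auto simp: r_def intro!: continuous_intros)
  qed
  have eq: "averaged_defect K g \<xi> = (\<integral>t. exp (- K * (1 - t)) *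
      (1 - config_prod (\<lambda>y. 1 - r t * (1 - g y)) \<xi>) * indicator {0..1} t \<partial>lborel)" for \<xi>
    unfolding averaged_defect_def
    by (intro Bochner_Integration.integral_cong) (auto simp: indicator_def r_def min_def max_def)
  show ?thesis
    unfolding eq[abs_def] by measurable
qed

section \<open>The identity for a single configuration\<close>

text \<open>
  The derivative of \<open>exp (- K * (1 - t)) * (1 - (\<Prod>z\<in>F. 1 - t * u z))\<close> is \<open>K\<close> times this
  function plus, for each \<open>y \<in> F\<close>, \<open>exp (- K * (1 - t)) * u y\<close> times the product over
  \<open>F - {y}\<close>. Writing that product as one minus its defect, integration over \<open>[0,1]\<close> gives the
  terms \<open>w * u y - u y * B (F - {y})\<close>.
\<close>

lemma defect_identity_finite:
  fixes u :: "'a \<Rightarrow> real" and K :: real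
  assumes "finite F"
  defines "B \<equiv> \<lambda>A. \<integral>t. exp (- K * (1 - t)) * (1 - (\<Prod>z\<in>A. 1 - t * u z)) * indicator {0..1} t \<partial>lborel"
    and "w \<equiv> \<integral>t. exp (- K * (1 - t)) * indicator {0..1} t \<partial>lborel"
  shows "w * (\<Sum>y\<in>F. u y) + K * B F = (\<Sum>y\<in>F. u y * B (F - {y})) + (1 - (\<Prod>z\<in>F. 1 - u z))"
proof -
  define P where "P A t = (\<Prod>z\<in>A. 1 - t * u z)" for A t
  define e where "e t = exp (- K * (1 - t))" for t
  have contP: "isCont (P A) t" for A t
    unfolding P_def[abs_def] by (intro continuous_intros)
  have conte: "isCont e t" for t
    unfolding e_def[abs_def] by (intro continuous_intros)
  have int: "integrable lborel (\<lambda>t. h t * indicator {0..1} t)"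
    if "\<And>t. isCont h t" for h :: "real \<Rightarrow> real"
    using borel_integrable_atLeastAtMost[of 0 1 h] that by (simp add: mult.commute indicator_def if_distrib cong: if_cong)
  have B: "B A = (\<integral>t. e t * (1 - P A t) * indicator {0..1} t \<partial>lborel)" for A
    by (simp add: B_def P_def e_def)
  have deriv: "((\<lambda>t. e t * (1 - P F t)) has_field_derivative
      K * (e t * (1 - P F t)) + e t * (\<Sum>y\<in>F. u y * P (F - {y}) t)) (at t)" for t
  proof -
    have "(P F has_field_derivative (\<Sum>y\<in>F. (- u y) * P (F - {y}) t)) (at t)"
      unfolding P_def[abs_def]
      by (rule has_field_derivative_prod) (auto intro!: derivative_eq_intros)
    moreover have "(e has_field_derivative K * e t) (at t)"
      unfolding e_def[abs_def] by (auto intro!: derivative_eq_intros)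
    ultimately show ?thesis
      by (auto intro!: derivative_eq_intros simp: sum_negf algebra_simps)
  qed
  have "(\<integral>t. (K * (e t * (1 - P F t)) + e t * (\<Sum>y\<in>F. u y * P (F - {y}) t)) *
      indicator {0..1} t \<partial>lborel) = e 1 * (1 - P F 1) - e 0 * (1 - P F 0)"
    by (rule integral_FTC_Icc_real) (auto intro: deriv intro!: continuous_intros contP conte)
  also have "\<dots> = 1 - (\<Prod>z\<in>F. 1 - u z)"
    by (simp add: e_def P_def)
  also have "(\<integral>t. (K * (e t * (1 - P F t)) + e t * (\<Sum>y\<in>F. u y * P (F - {y}) t)) *
      indicator {0..1} t \<partial>lborel) =
      (\<integral>t. K * (e t * (1 - P F t) * indicator {0..1} t) + (\<Sum>y\<in>F. u y *
        (e t * indicator {0..1} t - e t * (1 - P (F - {y}) t) * indicator {0..1} t)) \<partial>lborel)"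
    by (intro Bochner_Integration.integral_cong)
      (auto simp: algebra_simps sum_distrib_left sum_subtractf indicator_def)
  also have "\<dots> = K * B F + (\<Sum>y\<in>F. u y * (w - B (F - {y})))"
    unfolding B w_def e_def[symmetric]
    by (simp add: int contP conte)
  finally show ?thesis
    by (simp add: algebra_simps sum_subtractf sum_distrib_left)
qed


lemma config_prod_in_01:
  assumes "\<And>x. 0 \<le> g x \<and> g x \<le> 1"
  shows "0 \<le> config_prod g \<xi>" "config_prod g \<xi> \<le> 1"
  using assms by (auto simp: config_prod_def intro: prod_nonneg prod_le_1)

lemma exp_weight_integrable:
  fixes K :: real
  shows "integrable lborel (\<lambda>t::real. exp (- K * (1 - t)) * indicator {0..1} t)"
  using borel_integrable_atLeastAtMost[of 0 1 "\<lambda>t. exp (- K * (1 - t))"]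
  by (simp add: mult.commute indicator_def if_distrib cong: if_cong)

lemma averaged_defect_bounds:
  assumes g: "\<And>x. 0 \<le> g x \<and> g x \<le> 1"
  shows "0 \<le> averaged_defect K g \<xi>"
    "averaged_defect K g \<xi> \<le> (\<integral>t. exp (- K * (1 - t)) * indicator {0..1} t \<partial>lborel)"
proof -
  have P: "0 \<le> config_prod (\<lambda>y. 1 - t * (1 - g y)) \<xi> \<and> config_prod (\<lambda>y. 1 - t * (1 - g y)) \<xi> \<le> 1"
    if "t \<in> {0..1}" for t
  proof -
    have "0 \<le> 1 - t * (1 - g x) \<and> 1 - t * (1 - g x) \<le> 1" for x
      using that g[of x] by (auto intro: mult_le_one)
    then show ?thesis using config_prod_in_01[of "\<lambda>y. 1 - t * (1 - g y)"] by blast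
  qed
  show "0 \<le> averaged_defect K g \<xi>"
    unfolding averaged_defect_def
    by (intro Bochner_Integration.integral_nonneg) (use P in \<open>auto simp: indicator_def\<close>)
  show "averaged_defect K g \<xi> \<le> (\<integral>t. exp (- K * (1 - t)) * indicator {0..1} t \<partial>lborel)"
    unfolding averaged_defect_def
  proof (rule integral_mono')
    fix t :: real
    show "exp (- K * (1 - t)) * (1 - config_prod (\<lambda>y. 1 - t * (1 - g y)) \<xi>) * indicator {0..1} t
        \<le> exp (- K * (1 - t)) * indicator {0..1} t"
      using P[of t] by (auto simp: indicator_def mult_le_cancel_left1)
  qed (use exp_weight_integrable in simp_all)
qed

text \<open>
  Only the finitely many points with \<open>g y \<noteq> 1\<close> contribute to either side, so this is the
  identity for finite sets. It is stated between nonnegative extended reals, since the sums over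
  points will be integrated without first checking that they are integrable.
\<close>

lemma defect_identity:
  assumes g: "\<And>x. 0 \<le> g x \<and> g x \<le> 1"
    and fin: "finite {y \<in> \<xi>. g y \<noteq> 1}"
    and K: "0 \<le> K"
  defines "w \<equiv> \<integral>t. exp (- K * (1 - t)) * indicator {0..1} t \<partial>lborel"
  shows "ennreal w * config_sum (\<lambda>y. ennreal (1 - g y)) \<xi> + ennreal (K * averaged_defect K g \<xi>) =
    config_sum (\<lambda>y. ennreal ((1 - g y) * averaged_defect K g (\<xi> - {y}))) \<xi> +
    ennreal (1 - config_prod g \<xi>)"
proof -
  define F where "F = {y \<in> \<xi>. g y \<noteq> 1}"
  have F: "finite F" "F \<subseteq> \<xi>" using fin by (auto simp: F_def)
  have B0: "0 \<le> averaged_defect K g A" for A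
    by (rule averaged_defect_bounds(1)) (rule g)
  have remove: "{z \<in> \<xi> - {y}. g z \<noteq> 1} = F - {y}" for y by (auto simp: F_def)
  have B: "averaged_defect K g \<xi> =
      (\<integral>t. exp (- K * (1 - t)) * (1 - (\<Prod>z\<in>F. 1 - t * (1 - g z))) * indicator {0..1} t \<partial>lborel)"
    unfolding averaged_defect_def by (simp add: config_prod_thin fin F_def)
  have B': "averaged_defect K g (\<xi> - {y}) =
      (\<integral>t. exp (- K * (1 - t)) * (1 - (\<Prod>z\<in>F - {y}. 1 - t * (1 - g z))) * indicator {0..1} t \<partial>lborel)" for y
    unfolding averaged_defect_def
    by (subst config_prod_thin) (use F in \<open>simp_all add: remove del: Diff_iff\<close>)
  have "w * (\<Sum>y\<in>F. 1 - g y) + K * averaged_defect K g \<xi> =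
      (\<Sum>y\<in>F. (1 - g y) * averaged_defect K g (\<xi> - {y})) + (1 - config_prod g \<xi>)"
    using defect_identity_finite[OF F(1), of K "\<lambda>y. 1 - g y"]
    by (simp add: w_def B B' config_prod_def F_def)
  moreover have "config_sum (\<lambda>y. ennreal (1 - g y)) \<xi> = (\<Sum>y\<in>F. ennreal (1 - g y))"
    by (rule config_sum_eq_sum[OF F]) (auto simp: F_def)
  then have "config_sum (\<lambda>y. ennreal (1 - g y)) \<xi> = ennreal (\<Sum>y\<in>F. 1 - g y)"
    using g by (simp add: sum_ennreal)
  moreover have "config_sum (\<lambda>y. ennreal ((1 - g y) * averaged_defect K g (\<xi> - {y}))) \<xi> =
      (\<Sum>y\<in>F. ennreal ((1 - g y) * averaged_defect K g (\<xi> - {y})))"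
    by (rule config_sum_eq_sum[OF F]) (auto simp: F_def)
  then have "config_sum (\<lambda>y. ennreal ((1 - g y) * averaged_defect K g (\<xi> - {y}))) \<xi> =
      ennreal (\<Sum>y\<in>F. (1 - g y) * averaged_defect K g (\<xi> - {y}))"
    using g by (simp add: B0 sum_ennreal)
  moreover have "0 \<le> w" unfolding w_def by simp
  moreover have "0 \<le> (\<Sum>y\<in>F. 1 - g y)"
    using g by (intro sum_nonneg) simp
  moreover have "0 \<le> (\<Sum>y\<in>F. (1 - g y) * averaged_defect K g (\<xi> - {y}))"
    using g by (intro sum_nonneg) (simp add: B0)
  moreover have "0 \<le> K * averaged_defect K g \<xi>"
    using K by (simp add: B0)
  ultimately show ?thesis
    using config_prod_in_01[of g \<xi>] g
    by (simp flip: ennreal_plus ennreal_mult)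
qed

lemma one_minus_config_prod_le:
  assumes g: "\<And>x. 0 \<le> g x \<and> g x \<le> 1"
    and fin: "finite {y \<in> \<xi>. g y \<noteq> 1}"
  shows "ennreal (1 - config_prod g \<xi>) \<le> config_sum (\<lambda>y. ennreal (1 - g y)) \<xi>"
proof -
  define F where "F = {y \<in> \<xi>. g y \<noteq> 1}"
  have "config_sum (\<lambda>y. ennreal (1 - g y)) \<xi> = (\<Sum>y\<in>F. ennreal (1 - g y))"
    by (rule config_sum_eq_sum) (use fin in \<open>auto simp: F_def\<close>)
  also have "\<dots> = ennreal (\<Sum>y\<in>F. 1 - g y)"
    using g by (simp add: sum_ennreal)
  also have "\<dots> \<ge> ennreal (1 - config_prod g \<xi>)"
    using Weierstrass_prod_ineq[of F "\<lambda>y. 1 - g y"] g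
    by (intro ennreal_leI) (simp add: config_prod_def F_def)
  finally show ?thesis .
qed

lemma exp_weight_integral:
  fixes K :: real
  shows "K * (\<integral>t. exp (- K * (1 - t)) * indicator {0..1} t \<partial>lborel) = 1 - exp (- K)"
proof -
  have "(\<integral>t. (K * exp (- K * (1 - t))) * indicator {0..1} t \<partial>lborel) =
      exp (- K * (1 - 1 :: real)) - exp (- K * (1 - 0))"
    by (rule integral_FTC_Icc_real[of 0 1 "\<lambda>t. exp (- K * (1 - t))"])
      (auto intro!: derivative_eq_intros continuous_intros)
  then show ?thesis by (simp add: mult.assoc)
qed

section \<open>Expectations for locally stable Gibbs processes\<close>

text \<open>
  The Georgii--Nguyen--Zessin equation for \<open>h (x, \<xi>) = u x * B \<xi>\<close> turns the sum over removed
  points into an integral in which the conditional intensity appears, and local stability bounds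
  the latter by \<open>c\<close>. The spatial integral then factors out.
\<close>

lemma gibbs_process_reduced_Campbell_le:
  fixes ci :: "'a::euclidean_space \<Rightarrow> 'a set \<Rightarrow> real" and u :: "'a \<Rightarrow> real"
  assumes gibbs: "gibbs_process M \<Xi> ci" and stable: "locally_stable ci c" and c: "0 \<le> c"
    and [measurable]: "u \<in> borel_measurable borel" "B \<in> borel_measurable config_space"
    and u: "\<And>x. 0 \<le> u x" and B: "\<And>\<xi>. 0 \<le> B \<xi>"
  shows "(\<integral>\<^sup>+\<omega>. config_sum (\<lambda>y. ennreal (u y * B (\<Xi> \<omega> - {y}))) (\<Xi> \<omega>) \<partial>M) \<le>
    ennreal c * (\<integral>\<^sup>+x. ennreal (u x) \<partial>lborel) * (\<integral>\<^sup>+\<omega>. ennreal (B (\<Xi> \<omega>)) \<partial>M)"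
proof -
  have [measurable]: "\<Xi> \<in> M \<rightarrow>\<^sub>M config_space"
    using gibbs by (simp add: gibbs_process_def point_process_def)
  have "(\<lambda>(x, \<xi>). u x * B \<xi>) \<in> borel_measurable (borel \<Otimes>\<^sub>M config_space)"
    by measurable
  then have "(\<integral>\<^sup>+\<omega>. config_sum (\<lambda>y. ennreal (u y * B (\<Xi> \<omega> - {y}))) (\<Xi> \<omega>) \<partial>M) =
      (\<integral>\<^sup>+x. (\<integral>\<^sup>+\<omega>. ennreal (u x * B (\<Xi> \<omega>) * ci x (\<Xi> \<omega>)) \<partial>M) \<partial>lborel)"
    using gibbs[unfolded gibbs_process_def, THEN conjunct2, THEN conjunct2, rule_format,
        of "\<lambda>(x, \<xi>). u x * B \<xi>"] u B
    by (simp add: config_sum_def)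
  also have "\<dots> \<le> (\<integral>\<^sup>+x. (\<integral>\<^sup>+\<omega>. ennreal (u x) * (ennreal c * ennreal (B (\<Xi> \<omega>))) \<partial>M) \<partial>lborel)"
  proof (intro nn_integral_mono)
    fix x \<omega> assume "\<omega> \<in> space M"
    then have "\<Xi> \<omega> \<in> space config_space" by (rule measurable_space[rotated]) measurable
    then have "u x * B (\<Xi> \<omega>) * ci x (\<Xi> \<omega>) \<le> u x * B (\<Xi> \<omega>) * c"
      using stable u B by (intro mult_left_mono) (auto simp: locally_stable_def)
    then show "ennreal (u x * B (\<Xi> \<omega>) * ci x (\<Xi> \<omega>)) \<le> ennreal (u x) * (ennreal c * ennreal (B (\<Xi> \<omega>)))"
      using u B c by (simp add: ennreal_leI mult_ac flip: ennreal_mult)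
  qed
  also have "\<dots> = ennreal c * (\<integral>\<^sup>+x. ennreal (u x) \<partial>lborel) * (\<integral>\<^sup>+\<omega>. ennreal (B (\<Xi> \<omega>)) \<partial>M)"
    by (simp add: nn_integral_cmult nn_integral_multc mult_ac)
  finally show ?thesis .
qed

theorem theorem2p1:
  fixes M :: "'w measure"
    and \<Xi> :: "'w \<Rightarrow> 'a::euclidean_space set"
    and ci :: "'a \<Rightarrow> 'a set \<Rightarrow> real"
    and lam c G :: real
    and g :: "'a \<Rightarrow> real"
  assumes "prob_space M"
    and "gibbs_process M \<Xi> ci"
    and "stationary M \<Xi>"
    and "has_intensity M \<Xi> lam"
    and "c > 0"
    and "locally_stable ci c"
    and "g \<in> borel_measurable borel"
    and "\<And>x. 0 \<le> g x \<and> g x \<le> 1"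
    and "bounded (closure {x. 1 - g x \<noteq> 0})"
    and "G = (\<integral>x. (1 - g x) \<partial>lborel)"
  shows "1 - lam * G \<le> prob_space.expectation M (\<lambda>\<omega>. config_prod g (\<Xi> \<omega>)) \<and>
    prob_space.expectation M (\<lambda>\<omega>. config_prod g (\<Xi> \<omega>)) \<le> 1 - lam / c * (1 - exp (- c * G))"
proof -
  interpret prob_space M by fact
  note g = assms(8)
  note [measurable] = \<open>g \<in> borel_measurable borel\<close>
  have lam: "0 \<le> lam" using assms(4) by (simp add: has_intensity_def)
  have pp: "point_process M \<Xi>" using assms(2) by (simp add: gibbs_process_def)
  then have [measurable]: "\<Xi> \<in> M \<rightarrow>\<^sub>M config_space" by (simp add: point_process_def)
  have bdd: "bounded {x. g x \<noteq> 1}"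
    by (rule bounded_subset[OF assms(9)]) (use closure_subset in force)
  have fin: "finite {y \<in> \<Xi> \<omega>. g y \<noteq> 1}" if "\<omega> \<in> space M" for \<omega>
  proof -
    have "\<Xi> \<omega> \<in> space config_space" using that by (rule measurable_space[rotated]) measurable
    then have "finite (\<Xi> \<omega> \<inter> {x. g x \<noteq> 1})"
      using bdd by (simp add: space_config_space locally_finite_def)
    then show ?thesis by (simp add: Int_def)
  qed

  have "(\<integral>\<^sup>+x. ennreal (1 - g x) \<partial>lborel) \<le> (\<integral>\<^sup>+x. indicator {x. g x \<noteq> 1} x \<partial>lborel)"
    using g by (intro nn_integral_mono) (auto simp: indicator_def)
  also have "\<dots> < \<infinity>"
    using emeasure_bounded_finite[OF bdd] by simp
  finally have "integrable lborel (\<lambda>x. 1 - g x)"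
    using g by (intro integrableI_nonneg) auto
  then have G: "(\<integral>\<^sup>+x. ennreal (1 - g x) \<partial>lborel) = ennreal G"
    unfolding assms(10) using g by (intro nn_integral_eq_integral) auto
  have G0: "0 \<le> G" unfolding assms(10) using g by (intro Bochner_Integration.integral_nonneg) auto

  define S where "S \<omega> = config_sum (\<lambda>y. ennreal (1 - g y)) (\<Xi> \<omega>)" for \<omega>
  define P where "P \<omega> = config_prod g (\<Xi> \<omega>)" for \<omega>
  have [measurable]: "S \<in> borel_measurable M" "P \<in> borel_measurable M"
    unfolding S_def P_def
    by (rule measurable_compose[OF _ measurable_config_sum], measurable)
      (rule measurable_compose[OF _ measurable_config_prod[OF _ g bdd]], measurable)
  have ES: "(\<integral>\<^sup>+\<omega>. S \<omega> \<partial>M) = ennreal (lam * G)"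
    unfolding S_def using lam G0
    by (subst Campbell[OF pp assms(4)]) (simp_all add: G ennreal_mult)
  have P01: "0 \<le> P \<omega>" "P \<omega> \<le> 1" for \<omega>
    unfolding P_def by (rule config_prod_in_01[OF g])+
  have intP: "integrable M P"
    by (rule integrable_const_bound[of _ 1]) (use P01 in auto)
  have EP: "(\<integral>\<^sup>+\<omega>. ennreal (1 - P \<omega>) \<partial>M) = ennreal (1 - expectation P)"
    using intP P01 by (subst nn_integral_eq_integral) (auto simp: prob_space)
  have EP1: "0 \<le> 1 - expectation P"
    using intP P01 integral_le_const[of P 1] by auto

  have "(\<integral>\<^sup>+\<omega>. ennreal (1 - P \<omega>) \<partial>M) \<le> (\<integral>\<^sup>+\<omega>. S \<omega> \<partial>M)"
    unfolding S_def P_def by (intro nn_integral_mono one_minus_config_prod_le g fin)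
  then have lower: "1 - expectation P \<le> lam * G"
    using lam G0 by (simp add: ES EP)

  define K where "K = c * G"
  define B where "B = averaged_defect K g"
  define w where "w = (\<integral>t. exp (- K * (1 - t)) * indicator {0..1} t \<partial>lborel)"
  define T where "T \<omega> = config_sum (\<lambda>y. ennreal ((1 - g y) * B (\<Xi> \<omega> - {y}))) (\<Xi> \<omega>)" for \<omega>
  have K0: "0 \<le> K" unfolding K_def using G0 assms(5) by simp
  have w0: "0 \<le> w" unfolding w_def by simp
  have B01: "0 \<le> B \<xi>" "B \<xi> \<le> w" for \<xi>
    unfolding B_def w_def by (rule averaged_defect_bounds[OF g])+
  have mB: "B \<in> borel_measurable config_space"
    unfolding B_def by (rule measurable_averaged_defect[OF _ g bdd]) measurable
  have [measurable]: "(\<lambda>\<omega>. B (\<Xi> \<omega>)) \<in> borel_measurable M"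
    by (rule measurable_compose[OF _ mB]) measurable
  have id: "ennreal w * S \<omega> + ennreal (K * B (\<Xi> \<omega>)) = T \<omega> + ennreal (1 - P \<omega>)"
    if "\<omega> \<in> space M" for \<omega>
    unfolding S_def T_def P_def B_def w_def
    by (rule defect_identity[OF g fin[OF that] K0])
  define EB where "EB = (\<integral>\<^sup>+\<omega>. ennreal (K * B (\<Xi> \<omega>)) \<partial>M)"
  have "EB \<le> (\<integral>\<^sup>+\<omega>. ennreal (K * w) \<partial>M)"
    unfolding EB_def using B01 K0 by (intro nn_integral_mono ennreal_leI mult_left_mono)
  then have finEB: "EB \<noteq> \<infinity>"
    by (auto simp: emeasure_space_1 top_unique)
  have "(\<integral>\<^sup>+\<omega>. T \<omega> \<partial>M) \<le> ennreal c * ennreal G * (\<integral>\<^sup>+\<omega>. ennreal (B (\<Xi> \<omega>)) \<partial>M)"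
    unfolding T_def G[symmetric]
    by (rule gibbs_process_reduced_Campbell_le[OF assms(2,6)]) (use assms(5) g mB B01 in auto)
  also have "\<dots> = EB"
    unfolding EB_def using K0 G0 assms(5) B01
    by (simp add: K_def ennreal_mult nn_integral_cmult)
  finally have ET: "(\<integral>\<^sup>+\<omega>. T \<omega> \<partial>M) \<le> EB" .
  have "ennreal (w * (lam * G)) + EB = (\<integral>\<^sup>+\<omega>. ennreal w * S \<omega> + ennreal (K * B (\<Xi> \<omega>)) \<partial>M)"
    using w0 lam G0 by (simp add: nn_integral_add nn_integral_cmult ES EB_def ennreal_mult)
  also have "\<dots> = (\<integral>\<^sup>+\<omega>. T \<omega> + ennreal (1 - P \<omega>) \<partial>M)"
    by (intro nn_integral_cong id)
  also have "\<dots> = (\<integral>\<^sup>+\<omega>. T \<omega> \<partial>M) + ennreal (1 - expectation P)"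
  proof -
    \<comment> \<open>\<open>T\<close> involves configurations with a point removed, so its measurability is read off from
      the identity, whose other terms are already known to be measurable.\<close>
    have "T \<omega> = (ennreal w * S \<omega> + ennreal (K * B (\<Xi> \<omega>))) - ennreal (1 - P \<omega>)"
      if "\<omega> \<in> space M" for \<omega>
      by (simp add: id[OF that])
    then have "T \<in> borel_measurable M"
      by (subst measurable_cong) (assumption, measurable)
    then show ?thesis by (simp add: nn_integral_add EP)
  qed
  also have "\<dots> \<le> ennreal (1 - expectation P) + EB"
    using ET by (simp add: add.commute add_left_mono)
  finally have "ennreal (w * (lam * G)) \<le> ennreal (1 - expectation P)"
    using finEB by (simp add: ennreal_add_left_cancel_le add.commute[of _ EB])
  then have "w * (lam * G) \<le> 1 - expectation P"
    using EP1 by simp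
  moreover have "c * G * w = 1 - exp (- c * G)"
    using exp_weight_integral[of K, folded w_def] by (simp add: K_def)
  moreover have "w * (lam * G) = lam / c * (c * G * w)"
    using assms(5) by simp
  ultimately have "lam / c * (1 - exp (- c * G)) \<le> 1 - expectation P"
    by simp
  with lower show ?thesis
    unfolding P_def[abs_def] by simp
qed

end
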